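(* Fix $t\in\mathbb{R}$, an integer $n\ge1$ and $\lambda>0$. Let $r\to\infty$ and $q\to0$ with $rq=\lambda$ held fixed, and let $p=1-q$. Then $$\frac{A_n(t;p)}{r^{n}}\;\longrightarrow\;-\frac{(-1)^{n+1}B_{n+1}(t+1)}{n(n+1)}\,\frac1{\lambda^{n}},$$ where $$A_n(t;p)=\frac{(-1)^{n+1}}{n(n+1)}\Bigl[p^{n}B_{n+1}(t)-\Bigl(\frac pq\Bigr)^{n}B_{n+1}(t+1)-B_{n+1}\Bigr],$$ and $\sigma^{2}:=rq/p^{2}\to\lambda$. That is, the $n$-th term of the negative binomial expansion converges to the $n$-th term of the Poisson expansion.
   Context: $B_n(t)$ denotes the Bernoulli polynomials, $\sum_{n\ge0}B_n(t)z^n/n!=ze^{tz}/(e^z-1)$, and $B_n=B_n(0)$. The negative binomial expansion referred to is $\log[\sqrt{2\pi\sigma^{2}}\,P(\mu+t)]\sim\sum_{n\ge1}A_n(t;p)r^{-n}$ (as $r\to\infty$, $t$ bounded), where $P(k)=\frac{\Gamma(k+r)}{\Gamma(r)\Gamma(k+1)}p^{r}q^{k}$, $q=1-p$, $\mu=rq/p$, $\sigma^2=rq/p^2$. The Poisson expansion referred to is $$\log\Bigl[\sqrt{2\pi\lambda}\;e^{-\lambda}\frac{\lambda^{k}}{\Gamma(k+1)}\Bigr]\sim-\sum_{n\ge1}\frac{(-1)^{n+1}B_{n+1}(t+1)}{n(n+1)}\,\frac1{\lambda^{n}},\qquad k=\lambda+t,$$ as $\lambda\to\infty$ with $t$ bounded.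 The claim concerns only convergence of the individual terms. *)

theory Defs
  imports Complex_Main "HOL-Computational_Algebra.Formal_Power_Series"
begin

definition bernpoly :: "nat \<Rightarrow> real \<Rightarrow> real" where
  "bernpoly n t = fact n * fps_nth (fps_X * fps_exp t / (fps_exp 1 - 1)) n"

definition bernoulli :: "nat \<Rightarrow> real" where
  "bernoulli n = bernpoly n 0"

text \<open>
  The denominator of the quotient in \<^const>\<open>bernpoly\<close> has vanishing
  constant term; it is nevertheless an exact quotient of formal power series.
\<close>

lemma bernpoly_generating_function:
  "Abs_fps (\<lambda>n. bernpoly n t / fact n) * (fps_exp 1 - 1) = fps_X * fps_exp t"
proof -
  let ?d = "fps_exp 1 - 1 :: real fps"
  have d1: "fps_nth ?d 1 = 1" and d0: "fps_nth ?d 0 = 0"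
    by simp_all
  have nz: "?d \<noteq> 0"
    using d1 by (metis fps_zero_nth zero_neq_one)
  have sd: "subdegree ?d = 1"
    by (rule subdegreeI) (use d0 d1 in auto)
  have "?d dvd fps_X * fps_exp t"
    using nz sd by (simp add: fps_dvd_iff)
  then have "fps_X * fps_exp t / ?d * ?d = fps_X * fps_exp t"
    by simp
  moreover have "Abs_fps (\<lambda>n. bernpoly n t / fact n) = fps_X * fps_exp t / ?d"
    by (simp add: bernpoly_def fps_eq_iff)
  ultimately show ?thesis
    by simp
qed

text \<open>
  Coefficient of \<open>r\<^sup>-\<^sup>n\<close> in the expansion of the logarithm of the negative binomial mass function,
  normalised by \<open>sqrt (2 * pi * \<sigma>\<^sup>2)\<close>, at \<open>\<mu> + t\<close>; here \<open>q = 1 - p\<close>.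
\<close>

definition nb_coeff :: "nat \<Rightarrow> real \<Rightarrow> real \<Rightarrow> real" where
  "nb_coeff n t p =
     (-1) ^ (n + 1) / (real n * (real n + 1)) *
       (p ^ n * bernpoly (n + 1) t - (p / (1 - p)) ^ n * bernpoly (n + 1) (t + 1)
          - bernoulli (n + 1))"

end

theory Submission
  imports Defs
begin

text \<open>
  Only the middle one of the three terms of the coefficient survives the limit. Since
  \<open>r * q = lam\<close>, dividing it by \<open>r ^ n\<close> cancels the singularity of \<open>(p / q) ^ n\<close> at \<open>q = 0\<close>
  exactly: \<open>(p / q) ^ n / r ^ n = p ^ n / lam ^ n\<close>, which tends to \<open>1 / lam ^ n\<close> because
  \<open>p\<close> tends to \<open>1\<close>. The other two terms stay bounded before the division, so \<open>r ^ n\<close> sends them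
  to \<open>0\<close>. The values of the Bernoulli polynomials are constants throughout.
\<close>

text \<open>
  In this form the dependence on \<open>q\<close> is confined to \<open>p\<close> and the fixed product \<open>r * q\<close>, so that
  the limit can be taken term by term.
\<close>

lemma nb_coeff_over_power:
  fixes r q t :: real
  shows "nb_coeff n t (1 - q) / r ^ n =
     (-1) ^ (n + 1) / (real n * (real n + 1)) *
       ((1 - q) ^ n * bernpoly (n + 1) t * inverse (r ^ n)
          - (1 - q) ^ n / (r * q) ^ n * bernpoly (n + 1) (t + 1)
          - bernoulli (n + 1) * inverse (r ^ n))"
proof -
  have "((1 - q) / (1 - (1 - q))) ^ n * b * inverse (r ^ n) = (1 - q) ^ n / (r * q) ^ n * b" for b
    by (simp add: power_divide power_mult_distrib divide_inverse power_inverse)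
  then show ?thesis
    unfolding nb_coeff_def divide_inverse[of _ "r ^ n"] by (simp only: mult.assoc left_diff_distrib)
qed

theorem proposition4p6:
  fixes t lam :: real and n :: nat
    and r p q :: "'a \<Rightarrow> real" and F :: "'a filter"
  assumes "n \<ge> 1" and "lam > 0"
    and "filterlim r at_top F"
    and "(q \<longlongrightarrow> 0) F"
    and "\<forall>\<^sub>F x in F. r x * q x = lam"
    and "\<forall>\<^sub>F x in F. p x = 1 - q x"
  shows "((\<lambda>x. nb_coeff n t (p x) / r x ^ n) \<longlongrightarrow>
            - ((-1) ^ (n + 1) * bernpoly (n + 1) (t + 1) / (real n * (real n + 1)))
              * (1 / lam ^ n)) F
       \<and> ((\<lambda>x. r x * q x / (p x)\<^sup>2) \<longlongrightarrow> lam) F"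
proof
  let ?c = "(-1) ^ (n + 1) / (real n * (real n + 1))"
  have p_lim: "((\<lambda>x. 1 - q x) \<longlongrightarrow> 1) F"
    using tendsto_diff[OF tendsto_const assms(4), of 1] by simp
  have "filterlim (\<lambda>x. r x ^ n) at_top F"
    using assms(1,3) by (intro filterlim_pow_at_top) auto
  then have r_lim: "((\<lambda>x. inverse (r x ^ n)) \<longlongrightarrow> 0) F"
    by (rule tendsto_inverse_0_at_top)
  have "((\<lambda>x. ?c * ((1 - q x) ^ n * bernpoly (n + 1) t * inverse (r x ^ n)
            - (1 - q x) ^ n / lam ^ n * bernpoly (n + 1) (t + 1)
            - bernoulli (n + 1) * inverse (r x ^ n)))
        \<longlongrightarrow> ?c * (1 ^ n * bernpoly (n + 1) t * 0
            - 1 ^ n / lam ^ n * bernpoly (n + 1) (t + 1)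
            - bernoulli (n + 1) * 0)) F"
    using assms(2) by (intro tendsto_intros p_lim r_lim) auto
  moreover have "\<forall>\<^sub>F x in F. nb_coeff n t (p x) / r x ^ n =
      ?c * ((1 - q x) ^ n * bernpoly (n + 1) t * inverse (r x ^ n)
            - (1 - q x) ^ n / lam ^ n * bernpoly (n + 1) (t + 1)
            - bernoulli (n + 1) * inverse (r x ^ n))"
    using assms(5,6) by eventually_elim (simp only: nb_coeff_over_power)
  ultimately have "((\<lambda>x. nb_coeff n t (p x) / r x ^ n)
        \<longlongrightarrow> ?c * (1 ^ n * bernpoly (n + 1) t * 0
            - 1 ^ n / lam ^ n * bernpoly (n + 1) (t + 1)
            - bernoulli (n + 1) * 0)) F"
    by (simp only: tendsto_cong)
  then show "((\<lambda>x. nb_coeff n t (p x) / r x ^ n) \<longlongrightarrow>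
            - ((-1) ^ (n + 1) * bernpoly (n + 1) (t + 1) / (real n * (real n + 1)))
              * (1 / lam ^ n)) F"
    by simp

  have "((\<lambda>x. lam / (1 - q x)\<^sup>2) \<longlongrightarrow> lam / 1\<^sup>2) F"
    by (intro tendsto_intros p_lim) auto
  moreover have "\<forall>\<^sub>F x in F. r x * q x / (p x)\<^sup>2 = lam / (1 - q x)\<^sup>2"
    using assms(5,6) by eventually_elim simp
  ultimately show "((\<lambda>x. r x * q x / (p x)\<^sup>2) \<longlongrightarrow> lam) F"
    by (simp add: tendsto_cong)
qed

end
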